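(* Let $\alpha>0$ and $0<c<1$. Let $\widehat{M}_n$ be the monic orthogonal polynomials with respect to the weight $$\rho(x)=(\alpha)_x\frac{c^x}{x!},\qquad x\in\mathbb{N}_0$$ (monic Meixner polynomials). For $\beta>0$ let $P_{n,\beta}^{(1,1)}$ be the monic orthogonal polynomials with respect to $$\rho_\beta(x)=\frac{(\alpha)_x}{(\beta+1)_x}\frac{(c\beta)^x}{x!},\qquad x\in\mathbb{N}_0$$ (generalized Meixner polynomials with parameters $\alpha,\beta$ and $c\beta$). Then for every $n\in\mathbb{N}_0$ and every $x$, $$\lim_{\beta\to\infty}P_{n,\beta}^{(1,1)}(x)=\widehat{M}_n(x).$$
   Context: $(a)_x=a(a+1)\cdots(a+x-1)$, $(a)_0=1$, is the Pochhammer symbol, and $\mathbb{N}_0$ is the set of nonnegative integers. Given a positive weight $\rho$ with finite moments on $\mathbb{N}_0$, the monic orthogonal polynomials $P_n$ with respect to $\rho$ are the monic polynomials of degree $n$ satisfying $\sum_{x=0}^\infty P_n(x)x^k\rho(x)=0$ for $0\le k<n$. *)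

theory Defs
  imports "HOL-Analysis.Analysis" "HOL-Computational_Algebra.Polynomial" "HOL-Real_Asymp.Real_Asymp"
begin

definition positive_weight :: "(nat \<Rightarrow> real) \<Rightarrow> bool" where
  "positive_weight \<rho> \<longleftrightarrow>
     (\<forall>x. \<rho> x > 0) \<and> (\<forall>k. summable (\<lambda>x. real x ^ k * \<rho> x))"

definition is_monic_OP :: "(nat \<Rightarrow> real) \<Rightarrow> nat \<Rightarrow> real poly \<Rightarrow> bool" where
  "is_monic_OP \<rho> n p \<longleftrightarrow>
     degree p = n \<and> lead_coeff p = 1 \<and>
     (\<forall>k<n. (\<lambda>x. poly p (real x) * real x ^ k * \<rho> x) sums 0)"

(* Well defined for every positive weight, see ex1_monic_OP below. *)
definition monic_OP :: "(nat \<Rightarrow> real) \<Rightarrow> nat \<Rightarrow> real poly" where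
  "monic_OP \<rho> n = (THE p. is_monic_OP \<rho> n p)"

definition meixner_weight :: "real \<Rightarrow> real \<Rightarrow> nat \<Rightarrow> real" where
  "meixner_weight \<alpha> c x = pochhammer \<alpha> x * (c ^ x / fact x)"

definition gen_meixner_weight :: "real \<Rightarrow> real \<Rightarrow> real \<Rightarrow> nat \<Rightarrow> real" where
  "gen_meixner_weight \<alpha> \<beta> d x =
     pochhammer \<alpha> x / pochhammer (\<beta> + 1) x * (d ^ x / fact x)"

lemma summable_poly_weight:
  assumes "positive_weight \<rho>"
  shows "summable (\<lambda>x. poly p (real x) * \<rho> x)"
proof -
  have "summable (\<lambda>x. \<Sum>i\<le>degree p. coeff p i * (real x ^ i * \<rho> x))"
    using assms unfolding positive_weight_def
    by (intro summable_sum summable_mult) auto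
  thus ?thesis by (simp add: poly_altdef sum_distrib_right mult.assoc)
qed

definition weight_functional :: "(nat \<Rightarrow> real) \<Rightarrow> real poly \<Rightarrow> real" where
  "weight_functional \<rho> p = (\<Sum>x. poly p (real x) * \<rho> x)"

context
  fixes \<rho> :: "nat \<Rightarrow> real"
  assumes w: "positive_weight \<rho>"
begin

lemma weight_functional_sums: "(\<lambda>x. poly p (real x) * \<rho> x) sums weight_functional \<rho> p"
  unfolding weight_functional_def by (rule summable_sums[OF summable_poly_weight[OF w]])

lemma weight_functional_add:
  "weight_functional \<rho> (p + q) = weight_functional \<rho> p + weight_functional \<rho> q"
  by (rule sums_unique2[OF weight_functional_sums])
     (use sums_add[OF weight_functional_sums weight_functional_sums] in
       \<open>simp add: algebra_simps\<close>)

lemma weight_functional_smult: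
  "weight_functional \<rho> (smult a p) = a * weight_functional \<rho> p"
  by (rule sums_unique2[OF weight_functional_sums])
     (use sums_mult[OF weight_functional_sums] in \<open>simp add: algebra_simps\<close>)

lemma weight_functional_0: "weight_functional \<rho> 0 = 0"
  by (simp add: weight_functional_def)

lemma weight_functional_diff:
  "weight_functional \<rho> (p - q) = weight_functional \<rho> p - weight_functional \<rho> q"
  using weight_functional_add[of "p - q" q] by simp

lemma weight_functional_sum:
  "weight_functional \<rho> (sum f A) = (\<Sum>i\<in>A. weight_functional \<rho> (f i))"
  by (induction A rule: infinite_finite_induct)
     (simp_all add: weight_functional_0 weight_functional_add)

lemma weight_functional_square_pos:
  assumes "p \<noteq> 0"
  shows "weight_functional \<rho> (p * p) > 0"
proof -
  have "finite {x. poly p x = 0}" using assms by (rule poly_roots_finite)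
  hence "finite (real -` {x. poly p x = 0})"
    by (rule finite_vimageI) (simp add: inj_on_def)
  then obtain m where "m \<notin> real -` {x. poly p x = 0}"
    using ex_new_if_finite[OF infinite_UNIV_nat] by blast
  hence m: "poly p (real m) \<noteq> 0" by simp
  have pos: "\<rho> x > 0" for x using w by (simp add: positive_weight_def)
  show ?thesis unfolding weight_functional_def
  proof (rule suminf_pos2[where i = m])
    show "summable (\<lambda>x. poly (p * p) (real x) * \<rho> x)" by (rule summable_poly_weight[OF w])
    show "0 \<le> poly (p * p) (real x) * \<rho> x" for x
      using pos[of x] by (simp add: less_imp_le)
    show "0 < poly (p * p) (real m) * \<rho> m"
      using pos[of m] m by (metis mult_pos_pos not_real_square_gt_zero poly_mult)
  qed
qed

lemma is_monic_OP_iff: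
  "is_monic_OP \<rho> n p \<longleftrightarrow>
     degree p = n \<and> lead_coeff p = 1 \<and> (\<forall>k<n. weight_functional \<rho> (p * monom 1 k) = 0)"
proof -
  have "(\<lambda>x. poly p (real x) * real x ^ k * \<rho> x) sums 0 \<longleftrightarrow>
        weight_functional \<rho> (p * monom 1 k) = 0" for k
    using weight_functional_sums[of "p * monom 1 k"] sums_unique2
    by (fastforce simp: poly_monom)
  thus ?thesis unfolding is_monic_OP_def by simp
qed

lemma weight_functional_orth:
  assumes "\<And>k. k < n \<Longrightarrow> weight_functional \<rho> (p * monom 1 k) = 0"
    and "q = 0 \<or> degree q < n"
  shows "weight_functional \<rho> (p * q) = 0"
proof (cases "q = 0")
  case False
  hence d: "degree q < n" using assms(2) by simp
  have "p * q = p * (\<Sum>i\<le>degree q. monom (coeff q i) i)"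
    by (simp add: poly_as_sum_of_monoms)
  also have "\<dots> = (\<Sum>i\<le>degree q. smult (coeff q i) (p * monom 1 i))"
    unfolding sum_distrib_left
    by (rule sum.cong) (simp_all flip: mult_smult_right add: smult_monom)
  also have "weight_functional \<rho> \<dots> = (\<Sum>i\<le>degree q. coeff q i * weight_functional \<rho> (p * monom 1 i))"
    by (simp add: weight_functional_sum weight_functional_smult)
  also have "\<dots> = 0"
    using d assms(1) by (intro sum.neutral) auto
  finally show ?thesis .
qed (simp add: weight_functional_0)

lemma monic_diff_degree:
  fixes p q :: "real poly"
  assumes "degree p = n" "lead_coeff p = 1" "degree q = n" "lead_coeff q = 1"
  shows "p - q = 0 \<or> degree (p - q) < n"
proof (cases "n = 0")
  case True
  thus ?thesis using assms by (auto elim!: degree_eq_zeroE)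
next
  case False
  have "degree (p - q) \<le> n" using assms by (simp add: degree_diff_le)
  moreover have "coeff (p - q) n = 0" using assms by simp
  ultimately show ?thesis using False
    by (metis le_neq_implies_less leading_coeff_0_iff)
qed

lemma is_monic_OP_unique:
  assumes "is_monic_OP \<rho> n p" "is_monic_OP \<rho> n q"
  shows "p = q"
proof (rule ccontr)
  assume "p \<noteq> q"
  hence "weight_functional \<rho> ((p - q) * (p - q)) > 0"
    by (intro weight_functional_square_pos) simp
  moreover have d: "p - q = 0 \<or> degree (p - q) < n"
    using assms by (intro monic_diff_degree) (auto simp: is_monic_OP_iff)
  have "weight_functional \<rho> (p * (p - q)) = 0" "weight_functional \<rho> (q * (p - q)) = 0"
    using assms by (auto intro!: weight_functional_orth[OF _ d] simp: is_monic_OP_iff)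
  hence "weight_functional \<rho> ((p - q) * (p - q)) = 0"
    by (simp add: left_diff_distrib[of p q] weight_functional_diff)
  ultimately show False by simp
qed

lemma ex_is_monic_OP: "\<exists>p. is_monic_OP \<rho> n p"
proof (induction n rule: less_induct)
  case (less n)
  then obtain P where P: "\<And>m. m < n \<Longrightarrow> is_monic_OP \<rho> m (P m)" by metis
  define L where "L = weight_functional \<rho>"
  define r where "r = (\<Sum>m<n. smult (L (monom 1 n * P m) / L (P m * P m)) (P m))"
  define p where "p = monom 1 n - r"
  have P0: "P m \<noteq> 0" "degree (P m) = m" "lead_coeff (P m) = 1" if "m < n" for m
    using P[OF that] by (auto simp: is_monic_OP_def)
  have PP: "L (P i * P j) = 0" if "i < n" "j < n" "i \<noteq> j" for i j
  proof -
    have A: "L (P i * P j) = 0" if "i < n" "j < i" for i j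
      unfolding L_def
      by (rule weight_functional_orth[of i]) (use P[of i] P0 that in \<open>auto simp: is_monic_OP_iff\<close>)
    show ?thesis using A[of i j] A[of j i] that by (cases i j rule: linorder_cases) (auto simp: mult.commute)
  qed
  have coeff_r: "coeff r k = 0" if "k \<ge> n" for k
    unfolding r_def coeff_sum using P0 that
    by (intro sum.neutral) (auto simp: coeff_eq_0)
  have cp: "coeff p n = 1" by (simp add: p_def coeff_r)
  have "degree p \<le> n" by (rule degree_le) (auto simp: p_def coeff_r)
  hence dp: "degree p = n" using cp by (metis le_antisym le_degree zero_neq_one)
  have pP: "L (p * P m) = 0" if m: "m < n" for m
  proof -
    have "L (r * P m) = (\<Sum>i<n. L (monom 1 n * P i) / L (P i * P i) * L (P i * P m))"
      by (simp add: r_def L_def sum_distrib_right weight_functional_sum weight_functional_smult)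
    also have "\<dots> = (\<Sum>i\<in>{m}. L (monom 1 n * P i) / L (P i * P i) * L (P i * P m))"
      by (rule sum.mono_neutral_right) (use m PP in auto)
    also have "\<dots> = L (monom 1 n * P m)"
      using weight_functional_square_pos[OF P0(1)[OF m]] by (simp add: L_def)
    finally show ?thesis
      by (simp add: p_def L_def left_diff_distrib weight_functional_diff)
  qed
  have "L (p * monom 1 k) = 0" if "k < n" for k
    using that
  proof (induction k rule: less_induct)
    case (less k)
    have "monom 1 k - P k = 0 \<or> degree (monom 1 k - P k) < k"
      using P0[OF less.prems] by (intro monic_diff_degree) (auto simp: degree_monom_eq)
    moreover have "weight_functional \<rho> (p * monom 1 j) = 0" if "j < k" for j
      using less.IH[OF that] less.prems that by (simp add: L_def)
    ultimately have "L (p * (monom 1 k - P k)) = 0"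
      unfolding L_def by (rule weight_functional_orth[rotated])
    thus ?case using pP[OF less.prems]
      by (simp add: L_def right_diff_distrib weight_functional_diff)
  qed
  hence "is_monic_OP \<rho> n p" using dp cp by (simp add: is_monic_OP_iff L_def)
  thus ?case by blast
qed

lemma ex1_monic_OP: "\<exists>!p. is_monic_OP \<rho> n p"
  using ex_is_monic_OP is_monic_OP_unique by blast

lemma is_monic_OP_monic_OP: "is_monic_OP \<rho> n (monic_OP \<rho> n)"
  unfolding monic_OP_def by (rule theI'[OF ex1_monic_OP])

end

lemma positive_weight_ratio:
  assumes pos: "\<And>x. \<rho> x > 0"
    and lim: "(\<lambda>x. \<rho> (Suc x) / \<rho> x) \<longlonglongrightarrow> l" and "l < 1"
  shows "positive_weight \<rho>"
  unfolding positive_weight_def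
proof (intro conjI allI)
  fix k
  have "(\<lambda>x. 1 + 1 / real x) \<longlonglongrightarrow> 1 + 0"
    by (intro tendsto_intros lim_1_over_n)
  hence "(\<lambda>x. (1 + 1 / real x) ^ k * (\<rho> (Suc x) / \<rho> x)) \<longlonglongrightarrow> (1 + 0) ^ k * l"
    by (intro tendsto_intros lim)
  moreover obtain q where q: "l < q" "q < 1" using \<open>l < 1\<close> dense by blast
  ultimately have "\<forall>\<^sub>F x in sequentially. (1 + 1 / real x) ^ k * (\<rho> (Suc x) / \<rho> x) < q"
    by (intro order_tendstoD(2)) auto
  moreover have "\<forall>\<^sub>F x in sequentially. x > (0::nat)" by (rule eventually_gt_at_top)
  ultimately have "\<forall>\<^sub>F x in sequentially.
      norm (real (Suc x) ^ k * \<rho> (Suc x)) \<le> q * norm (real x ^ k * \<rho> x)"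
  proof eventually_elim
    case (elim x)
    have "real (Suc x) = (1 + 1 / real x) * real x" using elim by (simp add: field_simps)
    hence "real (Suc x) ^ k * \<rho> (Suc x) =
        (1 + 1 / real x) ^ k * (\<rho> (Suc x) / \<rho> x) * (real x ^ k * \<rho> x)"
      using pos[of x] by (simp add: power_mult_distrib)
    also have "\<dots> \<le> q * (real x ^ k * \<rho> x)"
      using elim pos[of x] by (intro mult_right_mono) (auto simp: less_imp_le)
    finally show ?case using pos[of x] pos[of "Suc x"]
      by (simp add: abs_mult abs_of_pos)
  qed
  then obtain N where "\<And>x. x \<ge> N \<Longrightarrow>
      norm (real (Suc x) ^ k * \<rho> (Suc x)) \<le> q * norm (real x ^ k * \<rho> x)"
    by (auto simp: eventually_sequentially)
  thus "summable (\<lambda>x. real x ^ k * \<rho> x)" using q(2) by (intro summable_ratio_test)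
qed (use pos in auto)

lemma positive_weight_meixner:
  assumes "\<alpha> > 0" "0 < c" "c < 1"
  shows "positive_weight (meixner_weight \<alpha> c)"
proof (rule positive_weight_ratio)
  show "meixner_weight \<alpha> c x > 0" for x
    using assms by (simp add: meixner_weight_def pochhammer_pos)
  have "meixner_weight \<alpha> c (Suc x) / meixner_weight \<alpha> c x = c * ((\<alpha> + real x) / (1 + real x))" for x
    using assms pochhammer_pos[of \<alpha> x]
    by (simp add: meixner_weight_def pochhammer_Suc divide_simps)
  moreover have "(\<lambda>x. c * ((\<alpha> + real x) / (1 + real x))) \<longlonglongrightarrow> c"
    by real_asymp
  ultimately show "(\<lambda>x. meixner_weight \<alpha> c (Suc x) / meixner_weight \<alpha> c x) \<longlonglongrightarrow> c" by simp
qed (use assms in auto)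

lemma positive_weight_gen_meixner:
  assumes "\<alpha> > 0" "\<beta> > 0" "d > 0"
  shows "positive_weight (gen_meixner_weight \<alpha> \<beta> d)"
proof (rule positive_weight_ratio)
  show "gen_meixner_weight \<alpha> \<beta> d x > 0" for x
    using assms by (simp add: gen_meixner_weight_def pochhammer_pos)
  have "gen_meixner_weight \<alpha> \<beta> d (Suc x) / gen_meixner_weight \<alpha> \<beta> d x =
      d * ((\<alpha> + real x) / (1 + real x)) / (\<beta> + 1 + real x)" for x
  proof -
    define A where "A = pochhammer \<alpha> x"
    define B where "B = pochhammer (\<beta> + 1) x"
    have "A > 0" "B > 0" "\<beta> + 1 + real x > 0"
      using assms by (auto simp: A_def B_def intro!: pochhammer_pos)
    thus ?thesis using assms
      unfolding gen_meixner_weight_def pochhammer_Suc A_def[symmetric] B_def[symmetric]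
      by (simp add: divide_simps)
  qed
  moreover have "(\<lambda>x. d * ((\<alpha> + real x) / (1 + real x)) / (\<beta> + 1 + real x)) \<longlonglongrightarrow> 0"
    by real_asymp
  ultimately show "(\<lambda>x. gen_meixner_weight \<alpha> \<beta> d (Suc x) / gen_meixner_weight \<alpha> \<beta> d x) \<longlonglongrightarrow> 0" by simp
qed auto

end

theory Submission
  imports Defs
begin

text \<open>
  Since \<open>\<beta>^x \<le> (\<beta>+1)\<^sub>x\<close>, the generalized Meixner weight is dominated by the Meixner weight, to
  which it converges pointwise; by Tannery's theorem all its moments converge.  By the
  Gram--Schmidt formula the coefficients of the monic orthogonal polynomials are rational functions
  of the moments whose denominators do not vanish in the limit, so they converge as well.
\<close>

section \<open>Gram-Schmidt recursion for monic orthogonal polynomials\<close>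

text \<open>The difference \<open>d\<close> of the two sides has no coefficient from degree
  \<open>n\<close> on and is orthogonal to every \<open>P m\<close> with \<open>m < n\<close>. Since
  the \<open>P m\<close> have all degrees below \<open>n\<close> and \<open>L\<close> is positive on
  nonzero squares, this forces \<open>d = 0\<close>.\<close>

lemma monic_OP_gram_schmidt:
  assumes w: "positive_weight \<rho>"
  defines "P \<equiv> monic_OP \<rho>" and "L \<equiv> weight_functional \<rho>"
  shows "P n = monom 1 n - (\<Sum>m<n. smult (L (monom 1 n * P m) / L (P m * P m)) (P m))"
proof -
  define r where "r = (\<Sum>m<n. smult (L (monom 1 n * P m) / L (P m * P m)) (P m))"
  define d where "d = P n - (monom 1 n - r)"
  have OP: "is_monic_OP \<rho> m (P m)" for m
    unfolding P_def by (rule is_monic_OP_monic_OP[OF w])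
  have deg: "degree (P m) = m" and lead: "coeff (P m) m = 1" and nz: "P m \<noteq> 0" for m
    using OP[of m] by (auto simp: is_monic_OP_def)
  have orth: "L (P m * q) = 0" if "q = 0 \<or> degree q < m" for m q
    unfolding L_def
    by (rule weight_functional_orth[OF w, of m]) (use OP[of m] that in \<open>auto simp: is_monic_OP_iff[OF w]\<close>)
  have PP: "L (P i * P j) = 0" if "i \<noteq> j" for i j
  proof (cases "j < i")
    case True
    thus ?thesis using orth[of "P j" i] deg by simp
  next
    case False
    thus ?thesis using orth[of "P i" j] deg that by (simp add: mult.commute[of "P i"])
  qed
  have rP: "L (r * P m) = L (monom 1 n * P m)" if m: "m < n" for m
  proof -
    have "L (r * P m) = (\<Sum>i<n. L (monom 1 n * P i) / L (P i * P i) * L (P i * P m))"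
      by (simp add: r_def L_def sum_distrib_right weight_functional_sum[OF w]
          weight_functional_smult[OF w])
    also have "\<dots> = (\<Sum>i\<in>{m}. L (monom 1 n * P i) / L (P i * P i) * L (P i * P m))"
      by (rule sum.mono_neutral_right) (use m PP in auto)
    also have "\<dots> = L (monom 1 n * P m)"
      using weight_functional_square_pos[OF w nz[of m]] by (simp add: L_def)
    finally show ?thesis .
  qed
  have dP: "L (d * P m) = 0" if "m < n" for m
    using PP[of n m] rP[OF that] that
    by (simp add: d_def L_def left_diff_distrib weight_functional_diff[OF w])
  \<comment> \<open>At \<open>k = n\<close> the leading terms of \<open>P n\<close> and
    \<open>monom 1 n\<close> cancel, so a nonzero \<open>d\<close> has degree strictly below
    \<open>n\<close>.\<close>
  have coeff_d: "coeff d k = 0" if "k \<ge> n" for k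
  proof -
    have "coeff r k = 0"
      unfolding r_def coeff_sum using that by (intro sum.neutral) (auto simp: coeff_eq_0 deg)
    moreover have "coeff (P n) k = coeff (monom 1 n) k"
      using that lead[of n] by (cases "k = n") (auto simp: coeff_eq_0 deg)
    ultimately show ?thesis by (simp add: d_def)
  qed
  have "d = 0"
  proof (rule ccontr)
    assume "d \<noteq> 0"
    define e where "e = degree d"
    define a where "a = lead_coeff d"
    have "a \<noteq> 0" using \<open>d \<noteq> 0\<close> by (simp add: a_def)
    hence "e < n" using coeff_d[of e] by (fastforce simp: a_def e_def)
    \<comment> \<open>Subtracting \<open>a\<close> times the monic \<open>P e\<close> kills the
      leading term of \<open>d\<close>. The remainder is orthogonal to \<open>P e\<close>, which
      leaves \<open>L (d * P e) = a * L (P e * P e)\<close>, a nonzero number, against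
      \<open>dP\<close>.\<close>
    have "d - smult a (P e) = 0 \<or> degree (d - smult a (P e)) < e"
    proof (rule disjCI)
      assume "\<not> degree (d - smult a (P e)) < e"
      moreover have "degree (d - smult a (P e)) \<le> e"
        by (intro degree_diff_le) (auto simp: e_def deg \<open>a \<noteq> 0\<close>)
      moreover have "coeff (d - smult a (P e)) e = 0"
        using lead[of e] by (simp add: a_def e_def)
      ultimately show "d - smult a (P e) = 0"
        by (metis le_neq_implies_less leading_coeff_0_iff)
    qed
    hence "L (P e * (d - smult a (P e))) = 0" by (rule orth)
    hence "L (d * P e) = a * L (P e * P e)"
      by (simp add: L_def right_diff_distrib weight_functional_diff[OF w]
          weight_functional_smult[OF w] mult.commute)
    thus False
      using dP[OF \<open>e < n\<close>] \<open>a \<noteq> 0\<close> weight_functional_square_pos[OF w nz[of e]]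
      by (simp add: L_def)
  qed
  thus ?thesis unfolding d_def r_def by simp
qed

section \<open>Continuous dependence on the moments\<close>

text \<open>A bound \<open>N\<close> in place of the exact degree gives all members of a family of
  polynomials the same summation range.\<close>

lemma weight_functional_conv_moments:
  assumes w: "positive_weight \<rho>" and "degree p \<le> N"
  shows "weight_functional \<rho> p = (\<Sum>i\<le>N. coeff p i * weight_functional \<rho> (monom 1 i))"
proof -
  have "p = (\<Sum>i\<le>N. smult (coeff p i) (monom 1 i))"
    using poly_as_sum_of_monoms'[OF assms(2)] by (simp add: smult_monom)
  hence "weight_functional \<rho> p = weight_functional \<rho> (\<Sum>i\<le>N. smult (coeff p i) (monom 1 i))"
    by simp
  thus ?thesis by (simp only: weight_functional_sum[OF w] weight_functional_smult[OF w])
qed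

text \<open>Coefficientwise convergence does not by itself bound the degrees of the
  \<open>q b\<close>. With the uniform bound \<open>N\<close>, the functional is a sum of products
  of coefficients and moments over a fixed finite range, so termwise limits suffice.\<close>

lemma tendsto_weight_functional:
  assumes w: "positive_weight \<rho>" and w': "\<forall>\<^sub>F b in F. positive_weight (\<sigma> b)"
    and moments: "\<And>k. ((\<lambda>b. weight_functional (\<sigma> b) (monom 1 k))
                      \<longlongrightarrow> weight_functional \<rho> (monom 1 k)) F"
    and coeffs: "\<And>i. ((\<lambda>b. coeff (q b) i) \<longlongrightarrow> coeff p i) F"
    and deg: "degree p \<le> N" and deg': "\<forall>\<^sub>F b in F. degree (q b) \<le> N"
  shows "((\<lambda>b. weight_functional (\<sigma> b) (q b)) \<longlongrightarrow> weight_functional \<rho> p) F"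
proof -
  have "((\<lambda>b. \<Sum>i\<le>N. coeff (q b) i * weight_functional (\<sigma> b) (monom 1 i)) \<longlongrightarrow>
      (\<Sum>i\<le>N. coeff p i * weight_functional \<rho> (monom 1 i))) F"
    by (intro tendsto_intros coeffs moments)
  moreover have "\<forall>\<^sub>F b in F. (\<Sum>i\<le>N. coeff (q b) i * weight_functional (\<sigma> b) (monom 1 i)) =
      weight_functional (\<sigma> b) (q b)"
    using w' deg' by eventually_elim (rule weight_functional_conv_moments[symmetric])
  ultimately show ?thesis
    unfolding weight_functional_conv_moments[OF w deg] by (rule Lim_transform_eventually)
qed

text \<open>Strong induction on \<open>n\<close> along the Gram-Schmidt recursion. The index
  \<open>i\<close> is generalized because numerators and denominators involve all coefficients of
  the lower polynomials.\<close>

lemma tendsto_coeff_monic_OP: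
  assumes w: "positive_weight \<rho>" and w': "\<forall>\<^sub>F b in F. positive_weight (\<sigma> b)"
    and moments: "\<And>k. ((\<lambda>b. weight_functional (\<sigma> b) (monom 1 k))
                      \<longlongrightarrow> weight_functional \<rho> (monom 1 k)) F"
  shows "((\<lambda>b. coeff (monic_OP (\<sigma> b) n) i) \<longlongrightarrow> coeff (monic_OP \<rho> n) i) F"
proof (induction n arbitrary: i rule: less_induct)
  case (less n)
  have deg: "degree (monic_OP \<rho>' m) = m" if "positive_weight \<rho>'" for \<rho>' m
    using is_monic_OP_monic_OP[OF that, of m] by (simp add: is_monic_OP_def)
  \<comment> \<open>Nonvanishing of the limits of the denominators is what lets the quotients
    converge.\<close>
  have nz: "weight_functional \<rho> (monic_OP \<rho> m * monic_OP \<rho> m) \<noteq> 0" for m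
    using weight_functional_square_pos[OF w, of "monic_OP \<rho> m"] is_monic_OP_monic_OP[OF w, of m]
    by (force simp: is_monic_OP_def)
  have num: "((\<lambda>b. weight_functional (\<sigma> b) (monom 1 n * monic_OP (\<sigma> b) m))
      \<longlongrightarrow> weight_functional \<rho> (monom 1 n * monic_OP \<rho> m)) F" if "m < n" for m
  proof (rule tendsto_weight_functional[OF w w' moments, where N = "n + m"])
    have le: "degree (monom 1 n * monic_OP \<rho>' m) \<le> n + m" if "positive_weight \<rho>'" for \<rho>'
      using degree_mult_le[of "monom 1 n" "monic_OP \<rho>' m"] deg[OF that]
      by (simp add: degree_monom_eq)
    show "degree (monom 1 n * monic_OP \<rho> m) \<le> n + m" by (rule le[OF w])
    show "\<forall>\<^sub>F b in F. degree (monom 1 n * monic_OP (\<sigma> b) m) \<le> n + m"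
      using w' by eventually_elim (rule le)
  \<comment> \<open>Each coefficient of a product is a convolution over a range independent of
    \<open>b\<close>, so the induction hypothesis applies termwise.\<close>
  qed (unfold coeff_mult, intro tendsto_intros less.IH[OF that])
  have den: "((\<lambda>b. weight_functional (\<sigma> b) (monic_OP (\<sigma> b) m * monic_OP (\<sigma> b) m))
      \<longlongrightarrow> weight_functional \<rho> (monic_OP \<rho> m * monic_OP \<rho> m)) F" if "m < n" for m
  proof (rule tendsto_weight_functional[OF w w' moments, where N = "m + m"])
    have le: "degree (monic_OP \<rho>' m * monic_OP \<rho>' m) \<le> m + m" if "positive_weight \<rho>'" for \<rho>'
      using degree_mult_le[of "monic_OP \<rho>' m" "monic_OP \<rho>' m"] deg[OF that] by simp
    show "degree (monic_OP \<rho> m * monic_OP \<rho> m) \<le> m + m" by (rule le[OF w])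
    show "\<forall>\<^sub>F b in F. degree (monic_OP (\<sigma> b) m * monic_OP (\<sigma> b) m) \<le> m + m"
      using w' by eventually_elim (rule le)
  qed (unfold coeff_mult, intro tendsto_intros less.IH[OF that])
  have GS: "coeff (monic_OP \<rho>' n) i = coeff (monom 1 n) i -
      (\<Sum>m<n. weight_functional \<rho>' (monom 1 n * monic_OP \<rho>' m) /
        weight_functional \<rho>' (monic_OP \<rho>' m * monic_OP \<rho>' m) * coeff (monic_OP \<rho>' m) i)"
    if "positive_weight \<rho>'" for \<rho>'
    by (subst monic_OP_gram_schmidt[OF that]) (simp add: coeff_sum)
  have "((\<lambda>b. coeff (monom 1 n) i -
      (\<Sum>m<n. weight_functional (\<sigma> b) (monom 1 n * monic_OP (\<sigma> b) m) /
        weight_functional (\<sigma> b) (monic_OP (\<sigma> b) m * monic_OP (\<sigma> b) m) *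
        coeff (monic_OP (\<sigma> b) m) i)) \<longlongrightarrow> coeff (monic_OP \<rho> n) i) F"
    unfolding GS[OF w] using less.IH num den nz by (intro tendsto_intros) auto
  moreover have "\<forall>\<^sub>F b in F. coeff (monom 1 n) i -
      (\<Sum>m<n. weight_functional (\<sigma> b) (monom 1 n * monic_OP (\<sigma> b) m) /
        weight_functional (\<sigma> b) (monic_OP (\<sigma> b) m * monic_OP (\<sigma> b) m) *
        coeff (monic_OP (\<sigma> b) m) i) = coeff (monic_OP (\<sigma> b) n) i"
    using w' by eventually_elim (simp add: GS)
  ultimately show ?case by (rule Lim_transform_eventually)
qed

section \<open>Convergence of the generalized Meixner moments\<close>

text \<open>Each of the \<open>k\<close> factors \<beta> + 1 + j is at least \<beta>. This supplies
  the domination for Tannery's theorem.\<close>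

lemma pochhammer_Suc_ge_power:
  fixes \<beta> :: real
  assumes "\<beta> \<ge> 0"
  shows "\<beta> ^ k \<le> pochhammer (\<beta> + 1) k"
proof (induction k)
  case (Suc k)
  have "\<beta> ^ k * \<beta> \<le> pochhammer (\<beta> + 1) k * (\<beta> + 1 + real k)"
    using assms Suc by (intro mult_mono) (auto simp: pochhammer_nonneg)
  thus ?case by (simp add: pochhammer_Suc mult.commute)
qed simp

text \<open>Each of the \<open>k\<close> factors \<beta> / (\<beta> + 1 + j) tends to 1. This
  supplies the pointwise convergence of the weights.\<close>

lemma tendsto_power_div_pochhammer:
  "((\<lambda>\<beta>::real. \<beta> ^ k / pochhammer (\<beta> + 1) k) \<longlongrightarrow> 1) at_top"
proof (induction k)
  case (Suc k)
  have "((\<lambda>\<beta>. \<beta> / (\<beta> + 1 + real k)) \<longlongrightarrow> 1) at_top" by real_asymp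
  from tendsto_mult[OF Suc this] show ?case by (simp add: pochhammer_Suc mult.commute)
qed simp

text \<open>Shows the purpose of the scaling \<open>c * \<beta>\<close>: the dependence on \<beta>
  is isolated in one factor, which for \<beta> > 0 is at most 1 and which tends to 1.\<close>

lemma gen_meixner_weight_scaled:
  "gen_meixner_weight \<alpha> \<beta> (c * \<beta>) x =
     meixner_weight \<alpha> c x * (\<beta> ^ x / pochhammer (\<beta> + 1) x)"
  by (simp add: gen_meixner_weight_def meixner_weight_def power_mult_distrib mult_ac)

lemma tendsto_moment_gen_meixner:
  assumes "\<alpha> > 0" "0 < c" "c < 1"
  shows "((\<lambda>\<beta>. weight_functional (gen_meixner_weight \<alpha> \<beta> (c * \<beta>)) (monom 1 k))
           \<longlongrightarrow> weight_functional (meixner_weight \<alpha> c) (monom 1 k)) at_top"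
proof -
  have pos: "meixner_weight \<alpha> c x > 0" for x
    using positive_weight_meixner[OF assms] by (simp add: positive_weight_def)
  have "((\<lambda>\<beta>. \<Sum>x. real x ^ k * gen_meixner_weight \<alpha> \<beta> (c * \<beta>) x)
      \<longlongrightarrow> (\<Sum>x. real x ^ k * meixner_weight \<alpha> c x)) at_top"
  \<comment> \<open>The third conjunct is the interchange of limit and sum; the majorant is the
    moment series of the Meixner weight itself.\<close>
  proof (rule tannerys_theorem[THEN conjunct2, THEN conjunct2])
    show "((\<lambda>\<beta>. real x ^ k * gen_meixner_weight \<alpha> \<beta> (c * \<beta>) x)
        \<longlongrightarrow> real x ^ k * meixner_weight \<alpha> c x) at_top" for x
      unfolding gen_meixner_weight_scaled
      using tendsto_mult[OF tendsto_const tendsto_mult[OF tendsto_const tendsto_power_div_pochhammer],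
          of "real x ^ k" "meixner_weight \<alpha> c x" x] by simp
    show "\<forall>\<^sub>F (x, \<beta>) in at_top \<times>\<^sub>F at_top.
        norm (real x ^ k * gen_meixner_weight \<alpha> \<beta> (c * \<beta>) x) \<le> real x ^ k * meixner_weight \<alpha> c x"
    proof -
      have "norm (real x ^ k * gen_meixner_weight \<alpha> \<beta> (c * \<beta>) x) \<le>
          real x ^ k * meixner_weight \<alpha> c x" if "\<beta> > 0" for x \<beta>
      proof -
        have p: "pochhammer (\<beta> + 1) x > 0" using that by (intro pochhammer_pos) simp
        have "\<beta> ^ x / pochhammer (\<beta> + 1) x \<le> 1"
          using pochhammer_Suc_ge_power[of \<beta> x] that p by simp
        hence "meixner_weight \<alpha> c x * (\<beta> ^ x / pochhammer (\<beta> + 1) x) \<le> meixner_weight \<alpha> c x * 1"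
          using pos[of x] by (intro mult_left_mono) auto
        moreover have "0 \<le> meixner_weight \<alpha> c x * (\<beta> ^ x / pochhammer (\<beta> + 1) x)"
          using pos[of x] that p by simp
        ultimately show ?thesis
          unfolding gen_meixner_weight_scaled real_norm_def abs_mult[of "real x ^ k"]
          by (intro mult_mono) auto
      qed
      thus ?thesis
        unfolding eventually_prod_filter
        \<comment> \<open>The bound holds at every \<open>x\<close>, so only \<beta> is
          restricted.\<close>
        by (intro exI[of _ "\<lambda>_. True"] exI[of _ "\<lambda>\<beta>. \<beta> > 0"]) (auto intro: eventually_gt_at_top)
    qed
    show "summable (\<lambda>x. real x ^ k * meixner_weight \<alpha> c x)"
      using positive_weight_meixner[OF assms] by (simp add: positive_weight_def)
  qed simp
  thus ?thesis by (simp add: weight_functional_def poly_monom)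
qed

text \<open>The polynomials have real coefficients; embedding these by \<open>of_real\<close> allows
  \<open>x\<close> in any real normed field, in particular complex \<open>x\<close>.\<close>

theorem mainTheorem5:
  fixes \<alpha> c :: real and n :: nat and x :: "'a :: real_normed_field"
  assumes "\<alpha> > 0" and "0 < c" and "c < 1"
  shows "((\<lambda>\<beta>. poly (map_poly of_real (monic_OP (gen_meixner_weight \<alpha> \<beta> (c * \<beta>)) n)) x)
           \<longlongrightarrow> poly (map_poly of_real (monic_OP (meixner_weight \<alpha> c) n)) x) at_top"
proof -
  have w: "positive_weight (meixner_weight \<alpha> c)" by (rule positive_weight_meixner[OF assms])
  have w': "\<forall>\<^sub>F \<beta> in at_top. positive_weight (gen_meixner_weight \<alpha> \<beta> (c * \<beta>))"
    using eventually_gt_at_top[of 0]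
    by eventually_elim (use assms in \<open>auto intro!: positive_weight_gen_meixner\<close>)
  \<comment> \<open>The degree is exactly \<open>n\<close> for every positive weight, so evaluation
    is a sum over a range independent of \<beta> and coefficientwise limits carry over.\<close>
  have eval: "poly (map_poly of_real (monic_OP \<rho> n)) x =
      (\<Sum>i\<le>n. of_real (coeff (monic_OP \<rho> n) i) * x ^ i)" if "positive_weight \<rho>" for \<rho>
    using is_monic_OP_monic_OP[OF that, of n]
    by (simp add: is_monic_OP_def poly_altdef coeff_map_poly degree_map_poly)
  have "((\<lambda>\<beta>. \<Sum>i\<le>n. of_real (coeff (monic_OP (gen_meixner_weight \<alpha> \<beta> (c * \<beta>)) n) i) * x ^ i)
      \<longlongrightarrow> poly (map_poly of_real (monic_OP (meixner_weight \<alpha> c) n)) x) at_top"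
    unfolding eval[OF w]
    by (intro tendsto_intros tendsto_coeff_monic_OP w w' tendsto_moment_gen_meixner assms)
  moreover have "\<forall>\<^sub>F \<beta> in at_top.
      (\<Sum>i\<le>n. of_real (coeff (monic_OP (gen_meixner_weight \<alpha> \<beta> (c * \<beta>)) n) i) * x ^ i) =
      poly (map_poly of_real (monic_OP (gen_meixner_weight \<alpha> \<beta> (c * \<beta>)) n)) x"
    using w' by eventually_elim (simp add: eval)
  ultimately show ?thesis by (rule Lim_transform_eventually)
qed

end
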